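(* For any integers $k > m \ge 2$ there exist $c>0$ and $n_0$ such that for all $n\ge n_0$, \[ f\left(n,k,\binom{k}{2} - m\cdot \left\lfloor\frac{k}{m+1}\right\rfloor + m+1 \right) \ge c\, n^{1+\frac{1}{m}}, \] that is, $f\left(n,k,\binom{k}{2} - m\left\lfloor\frac{k}{m+1}\right\rfloor + m+1 \right) = \Omega\left(n^{1+1/m}\right)$ as $n\to\infty$ (with $k,m$ fixed).
   Context: For positive integers $n,k,\ell$, let $f(n,k,\ell)$ denote the minimum number of colors used in an edge coloring of the complete graph $K_n$ with the property that for every set of $k$ vertices, the edges of the induced subgraph on these $k$ vertices receive at least $\ell$ distinct colors. *)

theory Defs
  imports Complex_Main "HOL-Library.Ramsey" "HOL-Library.Extended_Real"
begin

text \<open>The complete graph on a vertex set \<open>V\<close> has edge set \<^term>\<open>nsets V 2\<close>, and \<open>K\<^sub>n\<close> is taken on the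
  vertices \<^term>\<open>{..<n::nat}\<close>. A colouring is a function on edges; its values elsewhere are
  irrelevant. Every finite palette embeds into \<^typ>\<open>nat\<close>, so natural numbers suffice as colours.\<close>

definition kl_colouring :: "nat \<Rightarrow> nat \<Rightarrow> nat \<Rightarrow> (nat set \<Rightarrow> nat) \<Rightarrow> bool" where
  "kl_colouring n k l \<chi> \<longleftrightarrow> (\<forall>S \<in> nsets {..<n} k. l \<le> card (\<chi> ` nsets S 2))"

text \<open>If \<open>l > k choose 2\<close> and \<open>k \<le> n\<close> there is no such colouring at all. The minimum over the
  empty set is then \<open>\<infinity>\<close>, which is why the function takes values in \<^typ>\<open>enat\<close>.\<close>

definition gen_ramsey :: "nat \<Rightarrow> nat \<Rightarrow> nat \<Rightarrow> enat" where
  "gen_ramsey n k l =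
     (INF \<chi> \<in> {\<chi>. kl_colouring n k l \<chi>}. enat (card (\<chi> ` nsets {..<n} 2)))"

text \<open>Whenever a colouring exists, the infimum is an attained minimum.\<close>

lemma gen_ramsey_attained:
  assumes "kl_colouring n k l \<chi>0"
  obtains \<chi> where "kl_colouring n k l \<chi>" "gen_ramsey n k l = enat (card (\<chi> ` nsets {..<n} 2))"
proof -
  let ?A = "(\<lambda>\<chi>. enat (card (\<chi> ` nsets {..<n} 2))) ` {\<chi>. kl_colouring n k l \<chi>}"
  have "?A \<noteq> {}" using assms by blast
  then have "Inf ?A \<in> ?A" by (auto intro: wellorder_InfI)
  then show ?thesis using that unfolding gen_ramsey_def by auto
qed

text \<open>The subtraction in the number of colours of the main statement is never truncated.\<close>

lemma colours_not_truncated: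
  fixes k m :: nat
  assumes "2 \<le> m" "m < k"
  shows "m * (k div (m + 1)) \<le> k choose 2"
proof -
  have "m * (k div (m + 1)) \<le> (m + 1) * (k div (m + 1))" by simp
  also have "\<dots> \<le> k" by (rule times_div_less_eq_dividend)
  also have "k * 2 \<le> k * (k - 1)" using assms by (intro mult_le_mono) auto
  then have "k \<le> k choose 2" unfolding choose_two by linarith
  finally show ?thesis .
qed

end

theory Submission
  imports Defs "HOL-Library.Disjoint_Sets"
begin

text \<open>Fix a colouring with the required property, put \<open>q = \<lfloor>k / (m + 1)\<rfloor>\<close>, and for a set \<open>C\<close> of at most
  \<open>m\<close> colours let \<open>E\<close> be the graph of all edges with a colour in \<open>C\<close>. No set of at most \<open>k\<close> vertices
  spans \<open>m q\<close> edges of \<open>E\<close>. Hence \<open>E\<close> has no connected set of \<open>k\<close> vertices, as \<open>k - 1 \<ge> m q\<close>, and no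
  \<open>q\<close> disjoint stars with \<open>m\<close> edges, so all its stars with \<open>m\<close> edges live in fewer than \<open>q\<close> components
  of fewer than \<open>k\<close> vertices each: their number is bounded by a constant. Every \<open>(m + 1)\<close>-set of
  vertices carries a star, whose colours form one of at most \<open>N ^ m\<close> sequences when there are \<open>N\<close>
  colours. Therefore \<open>n choose (m + 1)\<close> is at most a constant times \<open>N ^ m\<close>.\<close>

section \<open>Growing vertex sets along edges\<close>

lemma insert_edge_card:
  assumes "finite X" "x \<in> X" "y \<notin> X" "{x, y} \<in> E"
  shows "card (E \<inter> nsets X 2) < card (E \<inter> nsets (insert y X) 2)"
proof (rule psubset_card_mono)
  show "finite (E \<inter> nsets (insert y X) 2)"
    using assms(1) by (simp add: finite_imp_finite_nsets)
  have "x \<noteq> y" using assms by blast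
  then have "{x, y} \<in> nsets (insert y X) 2" "{x, y} \<notin> nsets X 2"
    using assms by (auto simp: nsets_def)
  moreover have "nsets X 2 \<subseteq> nsets (insert y X) 2"
    by (rule nsets_mono) auto
  ultimately show "E \<inter> nsets X 2 \<subset> E \<inter> nsets (insert y X) 2"
    using assms(4) by blast
qed

text \<open>The condition on \<open>T\<close> stands in for connectedness: it is all that the growth step preserves
  and needs.\<close>

lemma closed_superset:
  assumes "finite V" "T \<subseteq> V" "card T \<le> k"
    and "card T \<le> Suc (card (E \<inter> nsets T 2))"
    and sparse: "\<And>X. X \<subseteq> V \<Longrightarrow> card X = k \<Longrightarrow> Suc (card (E \<inter> nsets X 2)) < k"
  obtains X where "T \<subseteq> X" "X \<subseteq> V" "card X < k" "\<And>x y. x \<in> X \<Longrightarrow> y \<in> V \<Longrightarrow> {x, y} \<in> E \<Longrightarrow> y \<in> X"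
proof -
  have "\<exists>X. T \<subseteq> X \<and> X \<subseteq> V \<and> card X < k \<and> (\<forall>x\<in>X. \<forall>y\<in>V. {x, y} \<in> E \<longrightarrow> y \<in> X)"
    using assms(2-4)
  proof (induction "k - card T" arbitrary: T rule: less_induct)
    case less
    then have "card T < k"
      using sparse[of T] by fastforce
    show ?case
    proof (cases "\<forall>x\<in>T. \<forall>y\<in>V. {x, y} \<in> E \<longrightarrow> y \<in> T")
      case True
      then show ?thesis using less.prems \<open>card T < k\<close> by blast
    next
      case False
      then obtain x y where xy: "x \<in> T" "y \<in> V" "{x, y} \<in> E" "y \<notin> T" by blast
      have "finite T" using less.prems(1) assms(1) finite_subset by blast
      then have card: "card (insert y T) = Suc (card T)" using xy by simp
      \<comment> \<open>One more vertex brings at least one more edge, so the bound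
        \<open>card T \<le> Suc (card (E \<inter> nsets T 2))\<close> survives the step.\<close>
      have "card (E \<inter> nsets T 2) < card (E \<inter> nsets (insert y T) 2)"
        using insert_edge_card \<open>finite T\<close> xy by metis
      then have "\<exists>X. insert y T \<subseteq> X \<and> X \<subseteq> V \<and> card X < k
          \<and> (\<forall>x\<in>X. \<forall>y\<in>V. {x, y} \<in> E \<longrightarrow> y \<in> X)"
        using less.prems card \<open>card T < k\<close> xy(2) by (intro less.hyps) auto
      then show ?thesis by blast
    qed
  qed
  then show thesis using that by blast
qed

section \<open>Stars in a sparse graph\<close>

definition star_in :: "'a set set \<Rightarrow> 'a set \<Rightarrow> bool" where
  "star_in E S \<longleftrightarrow> finite S \<and> (\<exists>v\<in>S. \<forall>x\<in>S - {v}. {v, x} \<in> E)"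

text \<open>Distinct leaves give distinct edges at the centre. So a star is an admissible start for
  \<open>closed_superset\<close>, and on \<open>m + 1\<close> vertices it has at least
  \<open>m\<close> edges.\<close>

lemma card_star_edges:
  assumes "star_in E S"
  shows "card S \<le> Suc (card (E \<inter> nsets S 2))"
proof -
  obtain v where v: "v \<in> S" "\<forall>x\<in>S - {v}. {v, x} \<in> E" and "finite S"
    using assms by (auto simp: star_in_def)
  have "inj_on (\<lambda>x. {v, x}) (S - {v})"
    by (auto simp: inj_on_def doubleton_eq_iff)
  moreover have "(\<lambda>x. {v, x}) ` (S - {v}) \<subseteq> E \<inter> nsets S 2"
    using v by (auto simp: nsets_def)
  moreover have "finite (E \<inter> nsets S 2)"
    using \<open>finite S\<close> by (simp add: finite_imp_finite_nsets)
  ultimately have "card (S - {v}) \<le> card (E \<inter> nsets S 2)"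
    by (metis card_inj_on_le)
  then show ?thesis using v(1) \<open>finite S\<close> by (simp add: card_Diff_singleton)
qed

text \<open>From any vertex of the star one edge leads to the centre, and from there one edge leads
  to each leaf.\<close>

lemma star_subset_closed:
  assumes "star_in E S" "S \<subseteq> V" "S \<inter> X \<noteq> {}"
    and closed: "\<And>x y. x \<in> X \<Longrightarrow> y \<in> V \<Longrightarrow> {x, y} \<in> E \<Longrightarrow> y \<in> X"
  shows "S \<subseteq> X"
proof -
  obtain v where v: "v \<in> S" "\<forall>x\<in>S - {v}. {v, x} \<in> E"
    using assms(1) by (auto simp: star_in_def)
  obtain w where w: "w \<in> S" "w \<in> X" using assms(3) by blast
  have "{w, v} \<in> E" if "w \<noteq> v"
    using v(2) w(1) that by (metis Diff_iff insert_commute singletonD)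
  then have "v \<in> X"
    using v(1) w closed[of w v] assms(2) by blast
  then show ?thesis
    using v closed[of v] assms(2) by blast
qed

lemma card_edges_disjoint_Union:
  assumes "disjoint D" "finite D" "\<And>T. T \<in> D \<Longrightarrow> finite T"
    and "\<And>T. T \<in> D \<Longrightarrow> m \<le> card (E \<inter> nsets T 2)"
  shows "m * card D \<le> card (E \<inter> nsets (\<Union>D) 2)"
proof -
  have "(E \<inter> nsets S 2) \<inter> (E \<inter> nsets T 2) = {}" if "S \<in> D" "T \<in> D" "S \<noteq> T" for S T
  proof -
    have "S \<inter> T = {}" using assms(1) that by (meson disjointD)
    then have "card e = 0" if "e \<subseteq> S" "e \<subseteq> T" for e
      using that by (metis Int_greatest card.empty subset_empty)
    then show ?thesis by (fastforce simp: nsets_def)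
  qed
  then have "card (\<Union>T\<in>D. E \<inter> nsets T 2) = (\<Sum>T\<in>D. card (E \<inter> nsets T 2))"
    using assms(2,3) by (intro card_UN_disjoint) (auto simp: finite_imp_finite_nsets)
  moreover have "m * card D \<le> (\<Sum>T\<in>D. card (E \<inter> nsets T 2))"
    using sum_bounded_below[of D m "\<lambda>T. card (E \<inter> nsets T 2)"] assms(4) by (simp add: mult.commute)
  moreover have "card (\<Union>T\<in>D. E \<inter> nsets T 2) \<le> card (E \<inter> nsets (\<Union>D) 2)"
    using assms(2,3) by (intro card_mono) (auto simp: finite_imp_finite_nsets nsets_def)
  ultimately show ?thesis by linarith
qed

text \<open>Take a largest disjoint subfamily \<open>D\<close> of \<open>F\<close>. It has fewer
  than \<open>q\<close> members, and each grows to a closed set of fewer than \<open>k\<close>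
  vertices. By maximality every star in \<open>F\<close> meets a member of \<open>D\<close>, hence
  lies in its closed set. So \<open>F\<close> consists of subsets of a set of at most
  \<open>q * k\<close> vertices, whatever the size of \<open>V\<close>.\<close>

lemma card_stars_bounded:
  assumes "finite V" "0 < q" "q * Suc m \<le> k"
    and sparse: "\<And>X. X \<subseteq> V \<Longrightarrow> card X \<le> k \<Longrightarrow> card (E \<inter> nsets X 2) < m * q"
    and F: "\<And>S. S \<in> F \<Longrightarrow> S \<in> nsets V (Suc m) \<and> star_in E S"
  shows "card F \<le> 2 ^ (q * k)"
proof -
  have "F \<subseteq> Pow V" using F by (auto simp: nsets_def)
  then have finF: "finite F" using assms(1) finite_subset by blast
  define DD where "DD = {D. D \<subseteq> F \<and> disjoint D}"
  have "finite DD" unfolding DD_def using finF by simp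
  moreover have "{} \<in> DD" by (simp add: DD_def)
  ultimately have "Max (card ` DD) \<in> card ` DD" by (intro Max_in) auto
  then obtain D where D: "D \<in> DD" "card D = Max (card ` DD)" by auto
  have max: "card D' \<le> card D" if "D' \<in> DD" for D'
    using that D(2) \<open>finite DD\<close> by simp
  have DF: "D \<subseteq> F" and disj: "disjoint D" using D(1) by (auto simp: DD_def)
  have finD: "finite D" using DF finF finite_subset by blast
  have edges: "m \<le> card (E \<inter> nsets S 2)" if "S \<in> F" for S
    using card_star_edges[of E S] F[OF that] by (auto simp: nsets_def)
  have "card D < q"
  proof (rule ccontr)
    assume "\<not> card D < q"
    then obtain D' where D': "D' \<subseteq> D" "card D' = q" "finite D'"
      by (metis obtain_subset_with_card_n not_less)
    have D'F: "S \<in> nsets V (Suc m)" "star_in E S" "S \<in> F" if "S \<in> D'" for S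
      using F DF D'(1) that by blast+
    have "card (\<Union>D') \<le> (\<Sum>S\<in>D'. card S)"
      using card_UN_le[OF D'(3), of id] by simp
    also have "\<dots> = q * Suc m"
      using D'F(1) D'(2) by (simp add: nsets_def)
    finally have "card (\<Union>D') \<le> k" using assms(3) by linarith
    moreover have "\<Union>D' \<subseteq> V" using D'F(1) by (auto simp: nsets_def)
    ultimately have "card (E \<inter> nsets (\<Union>D') 2) < m * q" using sparse by blast
    moreover have "m * card D' \<le> card (E \<inter> nsets (\<Union>D') 2)"
      using disj D' D'F edges
      by (intro card_edges_disjoint_Union) (auto simp: nsets_def intro: pairwise_subset)
    ultimately show False using D'(2) by simp
  qed
  have "\<exists>X. T \<subseteq> X \<and> X \<subseteq> V \<and> card X < k \<and> (\<forall>x\<in>X. \<forall>y\<in>V. {x, y} \<in> E \<longrightarrow> y \<in> X)"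
    if "T \<in> D" for T
  proof -
    have T: "T \<subseteq> V" "card T = Suc m" "star_in E T"
      using F DF that by (auto simp: nsets_def)
    have "Suc m \<le> q * Suc m" using mult_le_mono1[of 1 q "Suc m"] assms(2) by simp
    then have "card T \<le> k" using T(2) assms(3) by linarith
    moreover have "Suc (card (E \<inter> nsets X 2)) < k" if "X \<subseteq> V" "card X = k" for X
    proof -
      \<comment> \<open>Since \<open>k - 1 \<ge> m * q\<close>, sparseness leaves fewer than the
        \<open>k - 1\<close> edges that growth to \<open>k\<close> vertices would produce.\<close>
      have "m * q + 1 \<le> q * Suc m" using assms(2) by simp
      then show ?thesis using sparse[of X] that assms(3) by linarith
    qed
    ultimately show ?thesis
      using closed_superset[OF assms(1) T(1) _ card_star_edges[OF T(3)], of k] by metis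
  qed
  then obtain X where X: "\<And>T. T \<in> D \<Longrightarrow> T \<subseteq> X T \<and> X T \<subseteq> V \<and> card (X T) < k
      \<and> (\<forall>x\<in>X T. \<forall>y\<in>V. {x, y} \<in> E \<longrightarrow> y \<in> X T)"
    by metis
  have "F \<subseteq> Pow (\<Union>T\<in>D. X T)"
  proof
    fix S assume S: "S \<in> F"
    have "\<exists>T\<in>D. S \<inter> T \<noteq> {}"
    proof (rule ccontr)
      assume none: "\<not> (\<exists>T\<in>D. S \<inter> T \<noteq> {})"
      \<comment> \<open>Being nonempty, \<open>S\<close> would meet itself if it were in
        \<open>D\<close>; thus \<open>insert S D\<close> is strictly larger than
        \<open>D\<close>.\<close>
      have "S \<noteq> {}" using F[OF S] by (auto simp: nsets_def)
      then have "S \<notin> D" using none by auto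
      moreover have "insert S D \<in> DD"
        using none S DF disj by (auto simp: DD_def pairwise_insert disjnt_def)
      ultimately show False using max[of "insert S D"] finD by simp
    qed
    then obtain T where T: "T \<in> D" "S \<inter> T \<noteq> {}" by blast
    have "S \<subseteq> X T"
      using star_subset_closed[of E S V "X T"] F[OF S] X[OF T(1)] T(2) by (auto simp: nsets_def)
    then show "S \<in> Pow (\<Union>T\<in>D. X T)" using T(1) by blast
  qed
  moreover have fin: "finite (\<Union>T\<in>D. X T)"
    using finite_subset[OF _ assms(1)] X by (intro finite_UN_I finD) blast
  ultimately have "card F \<le> 2 ^ card (\<Union>T\<in>D. X T)"
    by (metis card_Pow card_mono finite_Pow_iff)
  also have "card (\<Union>T\<in>D. X T) \<le> (\<Sum>T\<in>D. card (X T))"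
    by (rule card_UN_le[OF finD])
  also have "\<dots> \<le> card D * k"
    using sum_bounded_above[of D "\<lambda>T. card (X T)" k] X less_imp_le by (metis of_nat_id)
  also have "\<dots> \<le> q * k" using \<open>card D < q\<close> by simp
  finally show ?thesis by (simp add: power_increasing)
qed

section \<open>From colourings to sparse graphs\<close>

text \<open>Enlarge \<open>X\<close> to a \<open>k\<close>-set. If \<open>m * q\<close> of its edges
  had colours in \<open>C\<close>, the other edges would show at most
  \<open>(k choose 2) - m * q\<close> colours and \<open>C\<close> adds at most \<open>m\<close>:
  one too few in total.\<close>

lemma few_edges_in_few_colours:
  assumes "kl_colouring n k ((k choose 2) - m * q + m + 1) \<chi>" "k \<le> n" "m * q \<le> k choose 2"
    and "finite C" "card C \<le> m" "X \<subseteq> {..<n}" "card X \<le> k"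
  shows "card (\<chi> -` C \<inter> nsets X 2) < m * q"
proof -
  obtain S where S: "X \<subseteq> S" "S \<subseteq> {..<n}" "card S = k"
    using exists_subset_between[of X k "{..<n}"] assms by auto
  have "finite S" using S(2) finite_subset by blast
  then have finS: "finite (nsets S 2)" by (simp add: finite_imp_finite_nsets)
  have cardS: "card (nsets S 2) = k choose 2"
    using S(3) by simp
  let ?A = "\<chi> -` C \<inter> nsets S 2"
  have "(k choose 2) - m * q + m + 1 \<le> card (\<chi> ` nsets S 2)"
    using assms(1) S \<open>finite S\<close> by (auto simp: kl_colouring_def nsets_def)
  also have "\<dots> \<le> card (\<chi> ` (nsets S 2 - ?A) \<union> C)"
    using finS assms(4) by (intro card_mono) auto
  also have "\<dots> \<le> card (\<chi> ` (nsets S 2 - ?A)) + card C"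
    by (rule card_Un_le)
  also have "\<dots> \<le> card (nsets S 2 - ?A) + m"
    using assms(5) finS by (intro add_mono card_image_le) auto
  also have "\<dots> = (k choose 2) - card ?A + m"
    using finS cardS by (simp add: card_Diff_subset)
  finally have "card ?A < m * q" using assms(3) by linarith
  moreover have "card (\<chi> -` C \<inter> nsets X 2) \<le> card ?A"
    using finS nsets_mono[OF S(1), of 2] by (intro card_mono) auto
  ultimately show ?thesis by linarith
qed

text \<open>The order on the vertices singles out one star in each set, centred at the minimum. A
  list, with possible repetitions, makes the number of values a plain power.\<close>

definition star_colours :: "('a::linorder set \<Rightarrow> 'b) \<Rightarrow> 'a set \<Rightarrow> 'b list" where
  "star_colours \<chi> S = map (\<lambda>x. \<chi> {Min S, x}) (sorted_list_of_set (S - {Min S}))"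

lemma star_colours_props:
  fixes V :: "'a::linorder set"
  assumes "S \<in> nsets V (Suc m)"
  shows "length (star_colours \<chi> S) = m" "set (star_colours \<chi> S) \<subseteq> \<chi> ` nsets V 2"
    and "star_in (\<chi> -` set (star_colours \<chi> S)) S"
proof -
  have S: "finite S" "S \<subseteq> V" "card S = Suc m" using assms by (auto simp: nsets_def)
  then have "S \<noteq> {}" by auto
  then have Min: "Min S \<in> S" using S(1) by simp
  then show "length (star_colours \<chi> S) = m"
    using S by (simp add: star_colours_def)
  have set: "set (star_colours \<chi> S) = (\<lambda>x. \<chi> {Min S, x}) ` (S - {Min S})"
    using S(1) by (simp add: star_colours_def)
  have "{Min S, x} \<in> nsets V 2" if "x \<in> S - {Min S}" for x
    using that Min S(2) by (auto simp: nsets_def)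
  then show "set (star_colours \<chi> S) \<subseteq> \<chi> ` nsets V 2"
    unfolding set by blast
  show "star_in (\<chi> -` set (star_colours \<chi> S)) S"
    unfolding star_in_def set using Min S(1) by blast
qed

text \<open>The \<open>(m + 1)\<close>-sets are sorted by the colour list of their star: one class
  for each of the lists in \<open>L\<close>, and each class is bounded by
  \<open>card_stars_bounded\<close>.\<close>

lemma binomial_le_colours_power:
  assumes "kl_colouring n k ((k choose 2) - m * q + m + 1) \<chi>" "k \<le> n" "m * q \<le> k choose 2"
    and "0 < q" "q * Suc m \<le> k"
  shows "n choose Suc m \<le> 2 ^ (q * k) * card (\<chi> ` nsets {..<n} 2) ^ m"
proof -
  let ?V = "{..<n}"
  let ?P = "nsets ?V (Suc m)"
  define L where "L = {xs. set xs \<subseteq> \<chi> ` nsets ?V 2 \<and> length xs = m}"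
  have finc: "finite (\<chi> ` nsets ?V 2)" by (simp add: finite_imp_finite_nsets)
  then have finL: "finite L" unfolding L_def by (rule finite_lists_length_eq)
  define B where "B xs = {S \<in> ?P. star_colours \<chi> S = xs}" for xs
  have fibre: "card (B xs) \<le> 2 ^ (q * k)" if "xs \<in> L" for xs
  proof (rule card_stars_bounded)
    have "card (set xs) \<le> m" using that card_length[of xs] by (simp add: L_def)
    then show "card (\<chi> -` set xs \<inter> nsets X 2) < m * q" if "X \<subseteq> ?V" "card X \<le> k" for X
      using few_edges_in_few_colours[OF assms(1-3)] that by blast
    show "S \<in> ?P \<and> star_in (\<chi> -` set xs) S" if "S \<in> B xs" for S
      using that star_colours_props(3) by (auto simp: B_def)
  qed (use assms in auto)
  have "star_colours \<chi> S \<in> L" if "S \<in> ?P" for S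
    using star_colours_props(1,2)[OF that, of \<chi>] by (simp add: L_def)
  then have "?P = (\<Union>xs\<in>L. B xs)"
    by (auto simp: B_def)
  then have "card ?P \<le> (\<Sum>xs\<in>L. card (B xs))"
    using card_UN_le[OF finL, of B] by simp
  also have "\<dots> \<le> card L * 2 ^ (q * k)"
    using sum_bounded_above[of L "\<lambda>xs. card (B xs)" "2 ^ (q * k)"] fibre by simp
  also have "card L = card (\<chi> ` nsets ?V 2) ^ m"
    unfolding L_def by (rule card_lists_length_eq[OF finc])
  finally show ?thesis by (simp add: mult.commute)
qed

section \<open>Extracting the exponent\<close>

lemma le_of_power_le_power:
  fixes a x :: real
  assumes "0 < m" "0 < a" "0 < x" "a * x ^ Suc m \<le> real N ^ m"
  shows "a powr (1 / m) * x powr (1 + 1 / m) \<le> real N"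
proof -
  have "(1 + 1 / m) * m = real (m + 1)" using assms(1) by (simp add: field_simps)
  then have "(a powr (1 / m) * x powr (1 + 1 / m)) ^ m = a powr 1 * x powr (m + 1)"
    using assms(1-3) by (simp add: power_mult_distrib powr_power mult.commute)
  also have "\<dots> = a * x ^ Suc m"
    using assms(2,3) powr_realpow[of x "Suc m"] by (simp add: add.commute)
  finally show ?thesis
    using assms(1,4) power_mono_iff[of "a powr (1 / m) * x powr (1 + 1 / m)" "real N" m] by simp
qed

theorem theorem1p1:
  fixes k m :: nat
  assumes "2 \<le> m" and "m < k"
  shows "\<exists>c::real. c > 0 \<and> (\<exists>n0::nat. \<forall>n\<ge>n0.
    ereal_of_enat (gen_ramsey n k ((k choose 2) - m * (k div (m + 1)) + m + 1))
      \<ge> ereal (c * real n powr (1 + 1 / real m)))"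
proof -
  define q where "q = k div (m + 1)"
  have q: "0 < q" "q * Suc m \<le> k" "m * q \<le> k choose 2"
    using assms colours_not_truncated[OF assms] div_times_less_eq_dividend[of k "m + 1"]
    by (simp_all add: q_def div_greater_zero_iff)
  let ?l = "(k choose 2) - m * q + m + 1"
  \<comment> \<open>The first factor comes from
    \<open>n choose Suc m \<ge> (n / Suc m) ^ Suc m\<close>, the second from the bound on a class of
    stars. The final constant is the \<open>m\<close>-th root of \<open>a\<close>, with
    \<open>n0 = k\<close>.\<close>
  define a :: real where "a = 1 / (real (Suc m) ^ Suc m * 2 ^ (q * k))"
  have "0 < a" by (simp add: a_def)
  have "ereal (a powr (1 / m) * real n powr (1 + 1 / m)) \<le> ereal_of_enat (gen_ramsey n k ?l)"
    if n: "n \<ge> k" for n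
  proof (cases "\<exists>\<chi>. kl_colouring n k ?l \<chi>")
    \<comment> \<open>This case occurs: for \<open>q = 1\<close> the required number of colours is
      \<open>(k choose 2) + 1\<close>, more than a \<open>k\<close>-set has edges.\<close>
    case False
    then have "gen_ramsey n k ?l = \<infinity>"
      by (simp add: gen_ramsey_def top_enat_def)
    then show ?thesis by simp
  next
    case True
    then obtain \<chi> where \<chi>: "kl_colouring n k ?l \<chi>"
      "gen_ramsey n k ?l = enat (card (\<chi> ` nsets {..<n} 2))"
      using gen_ramsey_attained by metis
    let ?N = "card (\<chi> ` nsets {..<n} 2)"
    have "a * real n ^ Suc m = (real n / Suc m) ^ Suc m / 2 ^ (q * k)"
      by (simp add: a_def power_divide)
    also have "\<dots> \<le> real (n choose Suc m) / 2 ^ (q * k)"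
      using n assms by (intro divide_right_mono binomial_ge_n_over_k_pow_k) auto
    also have "\<dots> \<le> real ?N ^ m"
    proof -
      have "real (n choose Suc m) \<le> real (2 ^ (q * k) * ?N ^ m)"
        using binomial_le_colours_power[OF \<chi>(1) n q(3,1,2)] of_nat_le_iff by blast
      then show ?thesis by (simp add: field_simps)
    qed
    finally have "a powr (1 / m) * real n powr (1 + 1 / m) \<le> real ?N"
      using assms n \<open>0 < a\<close> by (intro le_of_power_le_power) auto
    then show ?thesis using \<chi>(2) by simp
  qed
  moreover have "0 < a powr (1 / m)" using \<open>0 < a\<close> by simp
  ultimately show ?thesis unfolding q_def by blast
qed

end
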